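(* Let $(\Omega,\mathcal F,\mu)$ be a probability space, $\Gamma$ a difference operator on a class $\mathcal A$ of bounded measurable functions on $\Omega$, and assume that $\mu$ satisfies a $\Gamma\mathrm{-mLSI}(\rho)$ for some $\rho>0$. Let $f,g\in\mathcal A$ be such that $\Gamma(f)\le g$ and $\Gamma(g)\le b$ for a constant $b>0$. Then for all $t\ge0$ $$\mu\big(f-\mathbb E_\mu f\ge t\big)\le\frac43\exp\Big(-\frac1{8\rho}\min\Big(\frac{t^2}{(\mathbb E_\mu g)^2},\frac tb\Big)\Big).$$ If moreover $ah\in\mathcal A$ and $\Gamma(ah)=|a|\Gamma(h)$ for all $h\in\mathcal A$ and $a\in\mathbb R$, then the same upper bound holds for $\mu\big(\mathbb E_\mu f-f\ge t\big)$ for all $t\ge 0$.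
   Context: An operator $\Gamma$ on a class $\mathcal A$ of bounded measurable functions on a probability space $(\Omega,\mathcal F,\mu)$ is called a difference operator if (1) for all $f\in\mathcal A$, $\Gamma(f)$ is a non-negative measurable function; (2) for all $f\in\mathcal A$, $a\ge0$, $b\in\mathbb R$ we have $af+b\in\mathcal A$ and $\Gamma(af+b)=a\Gamma(f)$. No chain rule is assumed. $\mathbb E_\mu$ denotes expectation with respect to $\mu$, and for $h\ge0$, $\mathrm{Ent}_\mu(h)=\mathbb E_\mu h\log h-\mathbb E_\mu h\,\log(\mathbb E_\mu h)$. $\mu$ satisfies a $\Gamma\mathrm{-mLSI}(\rho)$, $\rho>0$, if $\mathrm{Ent}_\mu(e^f)\le\frac\rho2\,\mathbb E_\mu\big(\Gamma(f)^2e^f\big)$ for all $f\in\mathcal A$. Convention: $s/0=+\infty$ for $s>0$ and $0/0=0$. *)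

theory Defs
  imports "HOL-Probability.Probability"
begin

text \<open>
  Functions on \<open>\<Omega>\<close> are represented by functions on the whole type; everything required of them,
  including the homogeneity identity for \<open>\<Gamma>\<close>, concerns their values on \<open>space M\<close> only.
\<close>

definition difference_operator ::
  "'a measure \<Rightarrow> ('a \<Rightarrow> real) set \<Rightarrow> (('a \<Rightarrow> real) \<Rightarrow> 'a \<Rightarrow> real) \<Rightarrow> bool" where
  "difference_operator M A \<Gamma> \<longleftrightarrow>
     (\<forall>f\<in>A. f \<in> borel_measurable M \<and> bounded (f ` space M)) \<and>
     (\<forall>f\<in>A. \<Gamma> f \<in> borel_measurable M \<and> (\<forall>\<omega>\<in>space M. 0 \<le> \<Gamma> f \<omega>)) \<and>
     (\<forall>f\<in>A. \<forall>a b::real. 0 \<le> a \<longrightarrow>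
        (\<lambda>\<omega>. a * f \<omega> + b) \<in> A \<and>
        (\<forall>\<omega>\<in>space M. \<Gamma> (\<lambda>\<omega>'. a * f \<omega>' + b) \<omega> = a * \<Gamma> f \<omega>))"

definition Ent :: "'a measure \<Rightarrow> ('a \<Rightarrow> real) \<Rightarrow> real" where
  "Ent M h = (\<integral>\<omega>. h \<omega> * ln (h \<omega>) \<partial>M) - (\<integral>\<omega>. h \<omega> \<partial>M) * ln (\<integral>\<omega>. h \<omega> \<partial>M)"

text \<open>
  Since \<open>\<Gamma> f\<close> need not be bounded, the right-hand side of the inequality may be infinite and is
  a nonnegative integral. The left-hand side is a finite real, because \<open>f\<close> is bounded, and it is
  nonnegative by Jensen's inequality, so that \<open>ennreal\<close> does not truncate it.
\<close>

definition mLSI ::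
  "'a measure \<Rightarrow> ('a \<Rightarrow> real) set \<Rightarrow> (('a \<Rightarrow> real) \<Rightarrow> 'a \<Rightarrow> real) \<Rightarrow> real \<Rightarrow> bool" where
  "mLSI M A \<Gamma> \<rho> \<longleftrightarrow> 0 < \<rho> \<and>
     (\<forall>f\<in>A. ennreal (Ent M (\<lambda>\<omega>. exp (f \<omega>)))
        \<le> ennreal (\<rho> / 2) * (\<integral>\<^sup>+\<omega>. ennreal ((\<Gamma> f \<omega>)\<^sup>2 * exp (f \<omega>)) \<partial>M))"

text \<open>
  The exponent \<open>min (t\<^sup>2 / m\<^sup>2, t / b)\<close>. Division in \<^typ>\<open>ereal\<close> has \<open>s / 0 = \<infinity>\<close> for
  \<open>s > 0\<close> and \<open>0 / 0 = 0\<close>, whereas real division would give \<open>s / 0 = 0\<close>. For \<open>b > 0\<close> the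
  minimum is finite, so \<open>real_of_ereal\<close> loses nothing.
\<close>

definition two_level_rate :: "real \<Rightarrow> real \<Rightarrow> real \<Rightarrow> real" where
  "two_level_rate m b t = real_of_ereal (min (ereal (t\<^sup>2) / ereal (m\<^sup>2)) (ereal t / ereal b))"

end

theory Submission
  imports Defs
begin

text \<open>
  Feeding the entropy duality \<open>\<E>(X e\<^sup>F) \<le> Ent(e\<^sup>F) + \<E>(e\<^sup>F) ln \<E>(e\<^sup>X)\<close> with \<open>X = \<rho> l\<^sup>2 g\<^sup>2\<close> and
  \<open>F = l f\<close> into the modified log-Sobolev inequality, Herbst's argument gives the Bobkov--Goetze bound
  \<open>\<E> exp (L (f - \<E> f)) \<le> \<E> exp (\<rho> L\<^sup>2 g\<^sup>2)\<close>. As \<open>\<Gamma> g \<le> b\<close>, the same argument shows that the upper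
  tail of \<open>g - \<E> g\<close> is Gaussian with variance \<open>\<rho> b\<^sup>2\<close>; since \<open>g \<ge> 0\<close>, only this tail matters in
  \<open>g\<^sup>2 \<le> 2 (\<E> g)\<^sup>2 + 2 ((g - \<E> g)\<^sub>+)\<^sup>2\<close>, and the right-hand side is at most
  \<open>4/3 exp (2 \<rho> L\<^sup>2 (\<E> g)\<^sup>2)\<close> for \<open>L \<le> 1/(4 \<rho> b)\<close>. Markov's inequality with
  \<open>L = min (t/(4 \<rho> (\<E> g)\<^sup>2)) (1/(4 \<rho> b))\<close> concludes; for the lower tail, replace \<open>f\<close> by \<open>-f\<close>.
\<close>

section \<open>Integrability of continuous functions of bounded random variables\<close>

lemma bounded_image_continuous:
  fixes Y :: "'a \<Rightarrow> 'b::heine_borel" and \<phi> :: "'b \<Rightarrow> 'c::metric_space"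
  assumes \<phi>: "continuous_on UNIV \<phi>" and bdd: "bounded (Y ` S)"
  shows "bounded ((\<lambda>x. \<phi> (Y x)) ` S)"
proof -
  have "bounded (\<phi> ` closure (Y ` S))"
    using bdd by (intro compact_imp_bounded compact_continuous_image continuous_on_subset[OF \<phi>]) auto
  thus ?thesis
    using closure_subset[of "Y ` S"] by (elim bounded_subset) auto
qed

text \<open>Allowing vector-valued \<open>X\<close> makes mixed expressions such as
  \<open>X * exp F\<close> accessible: they are continuous functions of a bounded pair.\<close>

lemma (in finite_measure) integrable_continuous_bounded:
  fixes X :: "'a \<Rightarrow> 'b::euclidean_space" and \<phi> :: "'b \<Rightarrow> real"
  assumes \<phi>: "continuous_on UNIV \<phi>"
    and [measurable]: "X \<in> borel_measurable M" and bdd: "bounded (X ` space M)"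
  shows "integrable M (\<lambda>\<omega>. \<phi> (X \<omega>))"
proof -
  obtain B where "\<And>\<omega>. \<omega> \<in> space M \<Longrightarrow> norm (\<phi> (X \<omega>)) \<le> B"
    using bounded_image_continuous[OF \<phi> bdd] unfolding bounded_iff by blast
  moreover have "\<phi> \<in> borel_measurable borel"
    using \<phi> by (rule borel_measurable_continuous_onI)
  hence "(\<lambda>\<omega>. \<phi> (X \<omega>)) \<in> borel_measurable M"
    by measurable
  ultimately show ?thesis
    by (intro integrable_const_bound[where B = B]) auto
qed

section \<open>Moment generating functions and Herbst's argument\<close>

lemma (in prob_space) expectation_exp_pos:
  assumes "X \<in> borel_measurable M" and "bounded (X ` space M)"
  shows "0 < (\<integral>\<omega>. exp (l * X \<omega>) \<partial>M :: real)"
proof -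
  have int: "integrable M (\<lambda>\<omega>. exp (l * X \<omega>))"
    using assms by (intro integrable_continuous_bounded[of "\<lambda>x. exp (l * x)"]) (auto intro!: continuous_intros)
  obtain B where B: "\<And>\<omega>. \<omega> \<in> space M \<Longrightarrow> \<bar>X \<omega>\<bar> \<le> B"
    using assms(2) unfolding bounded_iff by fastforce
  have "exp (- \<bar>l\<bar> * B) \<le> exp (l * X \<omega>)" if "\<omega> \<in> space M" for \<omega>
  proof -
    have "\<bar>l * X \<omega>\<bar> \<le> \<bar>l\<bar> * B"
      unfolding abs_mult using B[OF that] by (intro mult_left_mono) auto
    thus ?thesis by simp
  qed
  hence "(\<integral>\<omega>. exp (- \<bar>l\<bar> * B) \<partial>M) \<le> (\<integral>\<omega>. exp (l * X \<omega>) \<partial>M)"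
    by (intro integral_mono int) auto
  moreover have "(\<integral>\<omega>. exp (- \<bar>l\<bar> * B) \<partial>M) = exp (- \<bar>l\<bar> * B)"
    by (simp add: prob_space)
  ultimately show ?thesis
    using exp_gt_zero[of "- \<bar>l\<bar> * B"] by linarith
qed

text \<open>Since \<open>X\<close> is bounded, the second-order Taylor remainder of
  \<open>exp\<close> is \<open>O(d\<^sup>2)\<close> uniformly on the space. Integrating this
  estimate justifies differentiation under the integral.\<close>

lemma (in prob_space) has_real_derivative_moment_generating:
  fixes X :: "'a \<Rightarrow> real"
  assumes X: "X \<in> borel_measurable M" and bdd: "bounded (X ` space M)"
  shows "((\<lambda>l. \<integral>\<omega>. exp (l * X \<omega>) \<partial>M) has_real_derivative (\<integral>\<omega>. X \<omega> * exp (l * X \<omega>) \<partial>M)) (at l)"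
proof -
  obtain B where "0 < B" and B: "\<And>\<omega>. \<omega> \<in> space M \<Longrightarrow> \<bar>X \<omega>\<bar> \<le> B"
    using bdd unfolding bounded_pos by fastforce
  define C where "C = exp (\<bar>l\<bar> * B) * (exp B * B\<^sup>2)"
  define u where "u l = (\<integral>\<omega>. exp (l * X \<omega>) \<partial>M)" for l
  define v where "v = (\<integral>\<omega>. X \<omega> * exp (l * X \<omega>) \<partial>M)"
  have int1: "integrable M (\<lambda>\<omega>. exp (l * X \<omega>))" for l
    using assms by (intro integrable_continuous_bounded[of "\<lambda>x. exp (l * x)"]) (auto intro!: continuous_intros)
  have int2: "integrable M (\<lambda>\<omega>. X \<omega> * exp (l * X \<omega>))"
    using assms by (intro integrable_continuous_bounded[of "\<lambda>x. x * exp (l * x)"]) (auto intro!: continuous_intros)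
  have quad: "\<bar>u (l + d) - u l - d * v\<bar> \<le> C * d\<^sup>2" if d: "\<bar>d\<bar> \<le> 1" for d
  proof -
    have pw: "\<bar>exp ((l + d) * X \<omega>) - exp (l * X \<omega>) - d * (X \<omega> * exp (l * X \<omega>))\<bar> \<le> C * d\<^sup>2"
      if w: "\<omega> \<in> space M" for \<omega>
    proof -
      \<comment> \<open>Taylor's formula with Lagrange remainder;
        \<open>\<bar>d\<bar> \<le> 1\<close> keeps the intermediate point \<open>s\<close> within
        \<open>[-B, B]\<close>.\<close>
      obtain s where s: "\<bar>s\<bar> \<le> \<bar>d * X \<omega>\<bar>"
        "exp (d * X \<omega>) = (\<Sum>m<2. (d * X \<omega>) ^ m / fact m) + exp s / fact 2 * (d * X \<omega>)\<^sup>2"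
        using Maclaurin_exp_le[of "d * X \<omega>" 2] by blast
      have dX: "\<bar>d * X \<omega>\<bar> \<le> B"
        unfolding abs_mult using mult_mono[OF d B[OF w]] by simp
      have expB: "exp s \<le> exp B"
        using s(1) dX by simp
      have Xsq: "(X \<omega>)\<^sup>2 \<le> B\<^sup>2"
        using power_mono[OF B[OF w], of 2] by simp
      have "\<bar>exp (d * X \<omega>) - 1 - d * X \<omega>\<bar> = exp s / 2 * (d\<^sup>2 * (X \<omega>)\<^sup>2)"
        using s(2) by (simp add: numeral_2_eq_2 power_mult_distrib)
      also have "\<dots> \<le> exp B * (d\<^sup>2 * B\<^sup>2)"
      proof (intro mult_mono mult_left_mono Xsq)
        show "exp s / 2 \<le> exp B"
          using expB exp_gt_zero[of s] by linarith
      qed auto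
      finally have *: "\<bar>exp (d * X \<omega>) - 1 - d * X \<omega>\<bar> \<le> exp B * (d\<^sup>2 * B\<^sup>2)" .
      have "\<bar>l * X \<omega>\<bar> \<le> \<bar>l\<bar> * B"
        unfolding abs_mult using B[OF w] by (intro mult_left_mono) auto
      hence **: "exp (l * X \<omega>) \<le> exp (\<bar>l\<bar> * B)" by simp
      have "\<bar>exp ((l + d) * X \<omega>) - exp (l * X \<omega>) - d * (X \<omega> * exp (l * X \<omega>))\<bar>
          = \<bar>exp (l * X \<omega>) * (exp (d * X \<omega>) - 1 - d * X \<omega>)\<bar>"
        by (simp add: algebra_simps exp_add)
      also have "\<dots> = exp (l * X \<omega>) * \<bar>exp (d * X \<omega>) - 1 - d * X \<omega>\<bar>"
        by (simp add: abs_mult)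
      also have "\<dots> \<le> exp (\<bar>l\<bar> * B) * (exp B * (d\<^sup>2 * B\<^sup>2))"
        by (intro mult_mono * **) auto
      finally show ?thesis by (simp add: C_def mult_ac)
    qed
    have eq: "u (l + d) - u l - d * v
        = (\<integral>\<omega>. exp ((l + d) * X \<omega>) - exp (l * X \<omega>) - d * (X \<omega> * exp (l * X \<omega>)) \<partial>M)"
      unfolding u_def v_def using int1 int2 by simp
    have "\<bar>u (l + d) - u l - d * v\<bar>
        \<le> (\<integral>\<omega>. \<bar>exp ((l + d) * X \<omega>) - exp (l * X \<omega>) - d * (X \<omega> * exp (l * X \<omega>))\<bar> \<partial>M)"
      unfolding eq by (rule integral_abs_bound)
    also have "\<dots> \<le> (\<integral>\<omega>. C * d\<^sup>2 \<partial>M)"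
      by (intro integral_mono pw integrable_abs Bochner_Integration.integrable_diff
          integrable_mult_right int1 int2 integrable_const)
    finally show ?thesis by (simp add: prob_space)
  qed
  have "((\<lambda>d. (u (l + d) - u l) / d - v) \<longlongrightarrow> 0) (at 0)"
  proof (rule Lim_null_comparison)
    show "\<forall>\<^sub>F d in at 0. norm ((u (l + d) - u l) / d - v) \<le> C * \<bar>d\<bar>"
      unfolding eventually_at
    proof (intro exI[of _ 1] conjI ballI impI)
      fix d :: real assume d: "d \<noteq> 0 \<and> dist d 0 < 1"
      have "norm ((u (l + d) - u l) / d - v) = \<bar>u (l + d) - u l - d * v\<bar> / \<bar>d\<bar>"
        using d by (simp add: abs_divide [symmetric] diff_divide_distrib)
      also have "\<dots> \<le> C * d\<^sup>2 / \<bar>d\<bar>"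
        using d by (intro divide_right_mono quad) auto
      also have "\<dots> = C * \<bar>d\<bar>"
        using d by (simp add: power2_eq_square field_simps abs_if)
      finally show "norm ((u (l + d) - u l) / d - v) \<le> C * \<bar>d\<bar>" .
    qed auto
    show "((\<lambda>d. C * \<bar>d\<bar>) \<longlongrightarrow> 0) (at 0)"
      by (auto intro!: tendsto_eq_intros)
  qed
  hence "(\<lambda>d. (u (l + d) - u l) / d) \<midarrow>0\<rightarrow> v"
    using LIM_zero_iff by blast
  thus ?thesis unfolding DERIV_def u_def v_def .
qed

text \<open>Herbst's argument: the hypothesis bounds the derivative of \<open>l \<mapsto> ln (u l) / l\<close> by \<open>c\<close>,
  and this function tends to the expectation of \<open>X\<close> at \<open>0\<close>.\<close>

lemma (in prob_space) Herbst:
  fixes X :: "'a \<Rightarrow> real"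
  assumes X: "X \<in> borel_measurable M" and bdd: "bounded (X ` space M)"
    and L: "0 < L"
    and Ent: "\<And>l. 0 < l \<Longrightarrow> l \<le> L \<Longrightarrow>
      Ent M (\<lambda>\<omega>. exp (l * X \<omega>)) \<le> c * l\<^sup>2 * (\<integral>\<omega>. exp (l * X \<omega>) \<partial>M)"
  shows "(\<integral>\<omega>. exp (L * X \<omega>) \<partial>M) \<le> exp (L * (\<integral>\<omega>. X \<omega> \<partial>M) + c * L\<^sup>2)"
proof -
  define u where "u l = (\<integral>\<omega>. exp (l * X \<omega>) \<partial>M)" for l
  define v where "v l = (\<integral>\<omega>. X \<omega> * exp (l * X \<omega>) \<partial>M)" for l
  have du: "(u has_real_derivative v l) (at l)" for l
    unfolding u_def v_def using X bdd by (rule has_real_derivative_moment_generating)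
  have pos: "0 < u l" for l
    unfolding u_def using X bdd by (rule expectation_exp_pos)
  have u0: "u 0 = 1" by (simp add: u_def prob_space)
  have v0: "v 0 = (\<integral>\<omega>. X \<omega> \<partial>M)" by (simp add: v_def)
  define G where "G l = ln (u l) / l - c * l" for l
  have mono: "G L \<le> G e" if e: "0 < e" "e \<le> L" for e
  proof (rule DERIV_nonpos_imp_nonincreasing[OF e(2)])
    fix l assume "e \<le> l" "l \<le> L"
    hence l: "0 < l" "l \<le> L" using e by auto
    define D where "D = (v l / u l * l - ln (u l) * 1) / (l * l) - c"
    \<comment> \<open>The entropy equals \<open>l\<^sup>2 * u l\<close> times the derivative of
      \<open>ln (u l) / l\<close>, so the entropy hypothesis says exactly that the derivative
      \<open>D\<close> of \<open>G\<close> is nonpositive.\<close>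
    have "Ent M (\<lambda>\<omega>. exp (l * X \<omega>)) = l * v l - u l * ln (u l)"
      unfolding Ent_def u_def v_def by (simp add: mult_ac flip: integral_mult_right_zero)
    hence "l * v l - u l * ln (u l) \<le> c * l\<^sup>2 * u l"
      using Ent[OF l] by (simp add: u_def)
    hence "(l * v l - u l * ln (u l)) / u l \<le> c * l\<^sup>2"
      using pos[of l] by (simp add: pos_divide_le_eq)
    hence "v l / u l * l - ln (u l) \<le> c * (l * l)"
      using pos[of l] by (simp add: diff_divide_distrib mult_ac power2_eq_square)
    hence "D \<le> 0"
      unfolding D_def using l by (simp add: pos_divide_le_eq)
    moreover have "(G has_real_derivative D) (at l)"
      unfolding G_def D_def using pos[of l] l
      by (auto intro!: derivative_eq_intros du simp: field_simps)
    ultimately show "\<exists>y. DERIV G l :> y \<and> y \<le> 0" by blast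
  qed
  \<comment> \<open>As \<open>ln (u 0) = 0\<close>, the quotient \<open>ln (u l) / l\<close> is the
    difference quotient of \<open>ln u\<close> at 0; this identifies its limit.\<close>
  have "((\<lambda>l. ln (u l)) has_real_derivative v 0) (at 0)"
    by (auto intro!: derivative_eq_intros du simp: u0)
  hence "((\<lambda>l. ln (u l) / l) \<longlongrightarrow> v 0) (at 0)"
    by (simp add: DERIV_def u0)
  hence "((\<lambda>l. ln (u l) / l) \<longlongrightarrow> v 0) (at_right 0)"
    by (rule tendsto_within_subset) simp
  moreover have "((\<lambda>l. c * l) \<longlongrightarrow> c * 0) (at_right 0)"
    by (intro tendsto_mult tendsto_const tendsto_ident_at)
  ultimately have "(G \<longlongrightarrow> v 0 - c * 0) (at_right 0)"
    unfolding G_def by (rule tendsto_diff)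
  moreover have "\<forall>\<^sub>F e in at_right 0. G L \<le> G e"
    unfolding eventually_at_right_field using L mono by (intro exI[of _ L]) auto
  ultimately have "G L \<le> v 0"
    by (intro tendsto_lowerbound) auto
  hence "ln (u L) / L \<le> v 0 + c * L" by (simp add: G_def)
  hence "ln (u L) \<le> (v 0 + c * L) * L"
    using L by (simp add: pos_divide_le_eq)
  hence "ln (u L) \<le> L * v 0 + c * L\<^sup>2" by (simp add: algebra_simps power2_eq_square)
  hence "u L \<le> exp (L * v 0 + c * L\<^sup>2)"
    using pos[of L] by (metis exp_ln exp_le_cancel_iff)
  thus ?thesis by (simp add: u_def v0)
qed

section \<open>Entropy duality and log-convexity of exponential moments\<close>

text \<open>This is nonnegativity of the relative entropy of the density \<open>exp F / U\<close>
  with respect to the density \<open>exp X / V\<close>, where \<open>U\<close> and \<open>V\<close>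
  are the normalising constants.\<close>

lemma (in prob_space) expectation_mult_exp_le_Ent:
  fixes F X :: "'a \<Rightarrow> real"
  assumes F: "F \<in> borel_measurable M" "bounded (F ` space M)"
    and X: "X \<in> borel_measurable M" "bounded (X ` space M)"
  shows "(\<integral>\<omega>. X \<omega> * exp (F \<omega>) \<partial>M)
    \<le> Ent M (\<lambda>\<omega>. exp (F \<omega>)) + (\<integral>\<omega>. exp (F \<omega>) \<partial>M) * ln (\<integral>\<omega>. exp (X \<omega>) \<partial>M)"
proof -
  define U where "U = (\<integral>\<omega>. exp (F \<omega>) \<partial>M)"
  define V where "V = (\<integral>\<omega>. exp (X \<omega>) \<partial>M)"
  have U: "0 < U" using expectation_exp_pos[OF F, of 1] by (simp add: U_def)
  have V: "0 < V" using expectation_exp_pos[OF X, of 1] by (simp add: V_def)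
  have FX: "(\<lambda>\<omega>. (F \<omega>, X \<omega>)) \<in> borel_measurable M" "bounded ((\<lambda>\<omega>. (F \<omega>, X \<omega>)) ` space M)"
    using F X by (auto intro: bounded_subset[OF bounded_Times])
  note int = integrable_continuous_bounded[OF _ FX]
  have i1: "integrable M (\<lambda>\<omega>. exp (F \<omega>))"
    using int[of "\<lambda>x. exp (fst x)"] by (simp add: continuous_intros)
  have i2: "integrable M (\<lambda>\<omega>. exp (X \<omega>))"
    using int[of "\<lambda>x. exp (snd x)"] by (simp add: continuous_intros)
  have i3: "integrable M (\<lambda>\<omega>. X \<omega> * exp (F \<omega>))"
    using int[of "\<lambda>x. snd x * exp (fst x)"] by (simp add: continuous_intros)
  have i4: "integrable M (\<lambda>\<omega>. exp (F \<omega>) * F \<omega>)"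
    using int[of "\<lambda>x. exp (fst x) * fst x"] by (simp add: continuous_intros)
  have pw: "X \<omega> * exp (F \<omega>) \<le> exp (F \<omega>) * F \<omega> - exp (F \<omega>) * (ln U - ln V + 1) + U / V * exp (X \<omega>)"
    (is "_ \<le> ?r \<omega>") for \<omega>
  proof -
    \<comment> \<open>The exponent is the logarithm of the ratio of the two normalised
      densities.\<close>
    have "1 + ((X \<omega> - ln V) - (F \<omega> - ln U)) \<le> exp ((X \<omega> - ln V) - (F \<omega> - ln U))"
      by (rule exp_ge_add_one_self)
    also have "\<dots> = U / V * exp (X \<omega>) / exp (F \<omega>)"
      using U V by (simp add: exp_diff exp_add)
    finally have "(1 + ((X \<omega> - ln V) - (F \<omega> - ln U))) * exp (F \<omega>) \<le> U / V * exp (X \<omega>)"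
      by (subst (asm) pos_le_divide_eq) auto
    thus ?thesis
      by (simp add: algebra_simps)
  qed
  have "(\<integral>\<omega>. X \<omega> * exp (F \<omega>) \<partial>M) \<le> (\<integral>\<omega>. ?r \<omega> \<partial>M)"
    using i1 i2 i3 i4 pw by (intro integral_mono) auto
  also have "\<dots> = (\<integral>\<omega>. exp (F \<omega>) * F \<omega> \<partial>M) - U * (ln U - ln V + 1) + U / V * V"
    using i1 i2 i4 by (simp add: U_def V_def)
  also have "\<dots> = Ent M (\<lambda>\<omega>. exp (F \<omega>)) + U * ln V"
    using V by (simp add: Ent_def U_def algebra_simps)
  finally show ?thesis by (simp add: U_def V_def)
qed

text \<open>Jensen's inequality for the concave power \<open>y \<mapsto> y powr s\<close>. It makes
  the logarithmic moment at most linear in the scale \<open>s\<close>, which Herbst's argument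
  needs.\<close>

lemma (in prob_space) ln_expectation_exp_scale_le:
  fixes X :: "'a \<Rightarrow> real"
  assumes X: "X \<in> borel_measurable M" "bounded (X ` space M)" and s: "0 \<le> s" "s \<le> 1"
  shows "ln (\<integral>\<omega>. exp (s * X \<omega>) \<partial>M) \<le> s * ln (\<integral>\<omega>. exp (X \<omega>) \<partial>M)"
proof -
  define V where "V = (\<integral>\<omega>. exp (X \<omega>) \<partial>M)"
  have V: "0 < V" using expectation_exp_pos[OF X, of 1] by (simp add: V_def)
  have int: "integrable M (\<lambda>\<omega>. exp (s * X \<omega>))" for s
    using X by (intro integrable_continuous_bounded[of "\<lambda>x. exp (s * x)"]) (auto intro!: continuous_intros)
  \<comment> \<open>The right-hand side is the tangent at \<open>V\<close> to the concave function
    \<open>y powr s\<close>, evaluated at \<open>y = exp (X \<omega>)\<close>.\<close>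
  have pw: "exp (s * X \<omega>) \<le> exp (s * ln V) * (1 - s + s / V * exp (X \<omega>))" for \<omega>
  proof -
    have "exp ((1 - s) *\<^sub>R 0 + s *\<^sub>R (X \<omega> - ln V)) \<le> (1 - s) * exp 0 + s * exp (X \<omega> - ln V)"
      using s by (intro convex_onD[OF exp_convex]) auto
    hence "exp (s * ln V) * exp (s * (X \<omega> - ln V)) \<le> exp (s * ln V) * (1 - s + s / V * exp (X \<omega>))"
      using V by (intro mult_left_mono) (auto simp: exp_diff)
    thus ?thesis by (simp add: algebra_simps flip: exp_add)
  qed
  have "(\<integral>\<omega>. exp (s * X \<omega>) \<partial>M) \<le> (\<integral>\<omega>. exp (s * ln V) * (1 - s + s / V * exp (X \<omega>)) \<partial>M)"
    using int[of 1] int[of s] pw by (intro integral_mono) auto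
  also have "\<dots> = exp (s * ln V) * (1 - s + s / V * V)"
    using int[of 1] by (simp add: V_def prob_space)
  also have "\<dots> = exp (s * ln V)" using V by simp
  finally have "ln (\<integral>\<omega>. exp (s * X \<omega>) \<partial>M) \<le> ln (exp (s * ln V))"
    using expectation_exp_pos[OF X, of s] by (subst ln_le_cancel_iff) auto
  thus ?thesis by (simp add: V_def)
qed

section \<open>Exponential squares of variables with Gaussian tails\<close>

lemma nn_integral_mult_exp_square:
  assumes k: "0 < k"
  shows "(\<integral>\<^sup>+s. ennreal (2 * k * s * exp (- k * s\<^sup>2)) * indicator {0..} s \<partial>lborel) = 1"
proof -
  have "(\<integral>\<^sup>+s. ennreal (2 * k * s * exp (- k * s\<^sup>2)) * indicator {0..} s \<partial>lborel)
      = ennreal (0 - (- exp (- k * 0\<^sup>2)))"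
  proof (rule nn_integral_FTC_atLeast)
    show "((\<lambda>s. - exp (- k * s\<^sup>2)) has_real_derivative 2 * k * s * exp (- k * s\<^sup>2)) (at s)" for s
      by (auto intro!: derivative_eq_intros)
    have "filterlim (\<lambda>s. k * s\<^sup>2) at_top at_top"
      using k by (intro filterlim_tendsto_pos_mult_at_top[OF tendsto_const] filterlim_pow_at_top filterlim_ident) auto
    hence "((\<lambda>s. exp (- k * s\<^sup>2)) \<longlongrightarrow> 0) at_top"
      by (auto intro!: filterlim_compose[OF exp_at_bot] simp: filterlim_uminus_at_bot)
    thus "((\<lambda>s. - exp (- k * s\<^sup>2)) \<longlongrightarrow> 0) at_top"
      using tendsto_minus by fastforce
  qed (use k in auto)
  thus ?thesis by simp
qed

text \<open>Writes \<open>exp (c * x\<^sup>2) - 1\<close> as the integral of a nonnegative weight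
  over \<open>[0, x]\<close>, the form required by the layer cake formula.\<close>

lemma nn_integral_mult_exp_square_atMost:
  assumes c: "0 < c" and x: "0 \<le> x"
  shows "(\<integral>\<^sup>+s. ennreal (2 * c * s * exp (c * s\<^sup>2)) * indicator {0..x} s \<partial>lborel) = ennreal (exp (c * x\<^sup>2) - 1)"
proof -
  have "(\<integral>\<^sup>+s. ennreal (2 * c * s * exp (c * s\<^sup>2)) * indicator {0..x} s \<partial>lborel)
      = ennreal (exp (c * x\<^sup>2) - exp (c * 0\<^sup>2))"
    by (rule nn_integral_FTC_Icc) (use c x in \<open>auto intro!: derivative_eq_intros\<close>)
  thus ?thesis by simp
qed

text \<open>With Gaussian tails \<open>exp (- 4 * c * s\<^sup>2)\<close>, the layer cake formula yields
  \<open>1 + \<integral> 2 * c * s * exp (c * s\<^sup>2) * exp (- 4 * c * s\<^sup>2) ds = 1 + 1 / 3\<close>.\<close>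

lemma (in prob_space) expectation_exp_square_le:
  fixes X :: "'a \<Rightarrow> real"
  assumes X [measurable]: "X \<in> borel_measurable M" and bdd: "bounded (X ` space M)" and c: "0 < c"
    and tail: "\<And>s. 0 < s \<Longrightarrow> prob {\<omega> \<in> space M. s \<le> X \<omega>} \<le> exp (- 4 * c * s\<^sup>2)"
  shows "(\<integral>\<omega>. exp (c * (max 0 (X \<omega>))\<^sup>2) \<partial>M) \<le> 4 / 3"
proof -
  interpret L: pair_sigma_finite M lborel ..
  define w where "w s = 2 * c * s * exp (c * s\<^sup>2)" for s :: real
  have [measurable]: "w \<in> borel_measurable borel" unfolding w_def by measurable
  have int: "integrable M (\<lambda>\<omega>. exp (c * (max 0 (X \<omega>))\<^sup>2))"
    using X bdd by (intro integrable_continuous_bounded[of "\<lambda>x. exp (c * (max 0 x)\<^sup>2)"]) (auto intro!: continuous_intros)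
  have "ennreal (\<integral>\<omega>. exp (c * (max 0 (X \<omega>))\<^sup>2) - 1 \<partial>M) = (\<integral>\<^sup>+\<omega>. ennreal (exp (c * (max 0 (X \<omega>))\<^sup>2) - 1) \<partial>M)"
    using int c by (intro nn_integral_eq_integral[symmetric]) auto
  also have "\<dots> = (\<integral>\<^sup>+\<omega>. (\<integral>\<^sup>+s. ennreal (w s) * indicator {0..max 0 (X \<omega>)} s \<partial>lborel) \<partial>M)"
    using c by (simp add: w_def nn_integral_mult_exp_square_atMost)
  also have "\<dots> = (\<integral>\<^sup>+\<omega>. (\<integral>\<^sup>+s. ennreal (w s) * (indicator {0<..} s * indicator {\<omega> \<in> space M. s \<le> X \<omega>} \<omega>) \<partial>lborel) \<partial>M)"
    by (intro nn_integral_cong) (auto simp: w_def indicator_def)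
  also have "\<dots> = (\<integral>\<^sup>+s. (\<integral>\<^sup>+\<omega>. ennreal (w s) * (indicator {0<..} s * indicator {\<omega> \<in> space M. s \<le> X \<omega>} \<omega>) \<partial>M) \<partial>lborel)"
    by (rule L.Fubini'[symmetric]) measurable
  also have "\<dots> = (\<integral>\<^sup>+s. ennreal (w s) * indicator {0<..} s * emeasure M {\<omega> \<in> space M. s \<le> X \<omega>} \<partial>lborel)"
    by (intro nn_integral_cong) (simp add: nn_integral_cmult mult.assoc[symmetric])
  also have "\<dots> \<le> (\<integral>\<^sup>+s. ennreal (1 / 3) * (ennreal (2 * (3 * c) * s * exp (- (3 * c) * s\<^sup>2)) * indicator {0..} s) \<partial>lborel)"
  proof (rule nn_integral_mono)
    fix s :: real
    show "ennreal (w s) * indicator {0<..} s * emeasure M {\<omega> \<in> space M. s \<le> X \<omega>}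
      \<le> ennreal (1 / 3) * (ennreal (2 * (3 * c) * s * exp (- (3 * c) * s\<^sup>2)) * indicator {0..} s)"
    proof (cases "0 < s")
      case True
      have "w s * prob {\<omega> \<in> space M. s \<le> X \<omega>} \<le> w s * exp (- 4 * c * s\<^sup>2)"
        using True c tail by (intro mult_left_mono) (auto simp: w_def)
      \<comment> \<open>The exponents add up to \<open>c - 4 * c = - 3 * c\<close>; the factor
        \<open>1 / 3\<close> normalises the weight to total mass 1.\<close>
      also have "\<dots> = 1 / 3 * (2 * (3 * c) * s * exp (- (3 * c) * s\<^sup>2))"
        by (simp add: w_def algebra_simps flip: exp_add)
      finally have "ennreal (w s * prob {\<omega> \<in> space M. s \<le> X \<omega>})
          \<le> ennreal (1 / 3 * (2 * (3 * c) * s * exp (- (3 * c) * s\<^sup>2)))"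
        by (rule ennreal_leI)
      also have "\<dots> = ennreal (1 / 3) * ennreal (2 * (3 * c) * s * exp (- (3 * c) * s\<^sup>2))"
        by (rule ennreal_mult'') (use True c in auto)
      finally show ?thesis
        using True c by (simp add: ennreal_mult'' emeasure_eq_measure)
    qed simp
  qed
  also have "\<dots> = ennreal (1 / 3)"
    using nn_integral_mult_exp_square[of "3 * c"] c by (subst nn_integral_cmult) auto
  finally have "(\<integral>\<omega>. exp (c * (max 0 (X \<omega>))\<^sup>2) - 1 \<partial>M) \<le> 1 / 3"
    by (simp add: ennreal_le_iff)
  thus ?thesis using int by (simp add: prob_space)
qed

section \<open>Chernoff bounds and consequences of the modified log-Sobolev inequality\<close>

lemma (in prob_space) prob_ge_le_exp_mult_expectation:
  fixes X :: "'a \<Rightarrow> real"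
  assumes X: "X \<in> borel_measurable M" "bounded (X ` space M)" and L: "0 < L"
  shows "prob {\<omega> \<in> space M. a \<le> X \<omega>} \<le> exp (- L * a) * (\<integral>\<omega>. exp (L * X \<omega>) \<partial>M)"
proof -
  have "integrable M (\<lambda>\<omega>. exp (L * X \<omega>))"
    using X by (intro integrable_continuous_bounded[of "\<lambda>x. exp (L * x)"]) (auto intro!: continuous_intros)
  hence "set_integrable M (space M) (\<lambda>\<omega>. exp (L * X \<omega>))" and "integrable M (\<lambda>\<omega>. exp (L * X \<omega>))"
    unfolding set_integrable_def by (auto intro!: integrable_mult_indicator simp del: real_scaleR_def)
  thus ?thesis
    using Chernoff_ineq_ge[OF L, of "space M" X a] by (simp add: set_integral_space)
qed

text \<open>Homogeneity applied to \<open>l * h\<close> produces the factor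
  \<open>l\<^sup>2\<close>. Replacing \<open>\<Gamma> h\<close> by the bounded majorant
  \<open>k\<close> makes the right-hand integral finite, so the inequality can be read in the
  reals.\<close>

lemma mLSI_imp_Ent_exp_le:
  assumes M: "prob_space M" and D: "difference_operator M A \<Gamma>" and mLSI: "mLSI M A \<Gamma> \<rho>"
    and h: "h \<in> A" and k: "k \<in> borel_measurable M" "bounded (k ` space M)"
    and le: "\<And>\<omega>. \<omega> \<in> space M \<Longrightarrow> \<Gamma> h \<omega> \<le> k \<omega>" and l: "0 \<le> l"
  shows "Ent M (\<lambda>\<omega>. exp (l * h \<omega>)) \<le> \<rho> / 2 * l\<^sup>2 * (\<integral>\<omega>. (k \<omega>)\<^sup>2 * exp (l * h \<omega>) \<partial>M)"
proof -
  interpret prob_space M by (rule M)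
  have \<rho>: "0 < \<rho>" using mLSI by (simp add: mLSI_def)
  have lh: "(\<lambda>\<omega>. l * h \<omega>) \<in> A" "\<And>\<omega>. \<omega> \<in> space M \<Longrightarrow> \<Gamma> (\<lambda>\<omega>. l * h \<omega>) \<omega> = l * \<Gamma> h \<omega>"
    using D h l unfolding difference_operator_def by (metis (no_types, lifting) add_0_right ext)+
  have h_meas: "h \<in> borel_measurable M" "bounded (h ` space M)"
    and nonneg: "\<And>\<omega>. \<omega> \<in> space M \<Longrightarrow> 0 \<le> \<Gamma> h \<omega>"
    using D h by (auto simp: difference_operator_def)
  have kh: "(\<lambda>\<omega>. (k \<omega>, h \<omega>)) \<in> borel_measurable M" "bounded ((\<lambda>\<omega>. (k \<omega>, h \<omega>)) ` space M)"
    using k h_meas by (auto intro: bounded_subset[OF bounded_Times])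
  have int: "integrable M (\<lambda>\<omega>. (l * k \<omega>)\<^sup>2 * exp (l * h \<omega>))"
    using integrable_continuous_bounded[OF _ kh, of "\<lambda>x. (l * fst x)\<^sup>2 * exp (l * snd x)"]
    by (simp add: continuous_intros)
  have "ennreal (Ent M (\<lambda>\<omega>. exp (l * h \<omega>)))
      \<le> ennreal (\<rho> / 2) * (\<integral>\<^sup>+\<omega>. ennreal ((\<Gamma> (\<lambda>\<omega>. l * h \<omega>) \<omega>)\<^sup>2 * exp (l * h \<omega>)) \<partial>M)"
    using mLSI lh(1) by (simp add: mLSI_def)
  also have "\<dots> \<le> ennreal (\<rho> / 2) * (\<integral>\<^sup>+\<omega>. ennreal ((l * k \<omega>)\<^sup>2 * exp (l * h \<omega>)) \<partial>M)"
    using l le nonneg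
    by (intro mult_left_mono nn_integral_mono ennreal_leI mult_right_mono power_mono) (auto simp: lh intro: mult_left_mono)
  also have "\<dots> = ennreal (\<rho> / 2) * ennreal (\<integral>\<omega>. (l * k \<omega>)\<^sup>2 * exp (l * h \<omega>) \<partial>M)"
    using int by (subst nn_integral_eq_integral) auto
  also have "\<dots> = ennreal (\<rho> / 2 * (\<integral>\<omega>. (l * k \<omega>)\<^sup>2 * exp (l * h \<omega>) \<partial>M))"
    using \<rho> by (intro ennreal_mult[symmetric] integral_nonneg) auto
  finally have "Ent M (\<lambda>\<omega>. exp (l * h \<omega>)) \<le> \<rho> / 2 * (\<integral>\<omega>. (l * k \<omega>)\<^sup>2 * exp (l * h \<omega>) \<partial>M)"
    using \<rho> by (subst (asm) ennreal_le_iff) (auto intro!: mult_nonneg_nonneg integral_nonneg)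
  thus ?thesis
    by (simp add: power_mult_distrib mult.assoc)
qed

text \<open>With the constant majorant \<open>b\<close>, Herbst's argument applies with
  \<open>c = \<rho> / 2 * b\<^sup>2\<close>; the Chernoff bound then gives the Gaussian
  tail.\<close>

lemma mLSI_Lipschitz_tail:
  assumes M: "prob_space M" and D: "difference_operator M A \<Gamma>" and mLSI: "mLSI M A \<Gamma> \<rho>"
    and h: "h \<in> A" and b: "0 < b" and le: "\<And>\<omega>. \<omega> \<in> space M \<Longrightarrow> \<Gamma> h \<omega> \<le> b" and s: "0 < s"
  shows "measure M {\<omega> \<in> space M. s \<le> h \<omega> - (\<integral>x. h x \<partial>M)} \<le> exp (- s\<^sup>2 / (2 * \<rho> * b\<^sup>2))"
proof -
  interpret prob_space M by (rule M)
  have \<rho>: "0 < \<rho>" using mLSI by (simp add: mLSI_def)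
  have h_meas: "h \<in> borel_measurable M" "bounded (h ` space M)"
    using D h by (auto simp: difference_operator_def)
  define m where "m = (\<integral>x. h x \<partial>M)"
  \<comment> \<open>The minimiser of the Chernoff exponent
    \<open>\<rho> / 2 * b\<^sup>2 * L\<^sup>2 - L * s\<close>.\<close>
  define L where "L = s / (\<rho> * b\<^sup>2)"
  have L: "0 < L" using s \<rho> b by (simp add: L_def)
  have "(\<integral>\<omega>. exp (L * h \<omega>) \<partial>M) \<le> exp (L * m + \<rho> / 2 * b\<^sup>2 * L\<^sup>2)"
    unfolding m_def
  proof (rule Herbst[OF h_meas L])
    fix l :: real assume "0 < l"
    hence "Ent M (\<lambda>\<omega>. exp (l * h \<omega>)) \<le> \<rho> / 2 * l\<^sup>2 * (\<integral>\<omega>. b\<^sup>2 * exp (l * h \<omega>) \<partial>M)"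
      by (intro mLSI_imp_Ent_exp_le[OF M D mLSI h] le) (auto simp: image_constant_conv)
    thus "Ent M (\<lambda>\<omega>. exp (l * h \<omega>)) \<le> \<rho> / 2 * b\<^sup>2 * l\<^sup>2 * (\<integral>\<omega>. exp (l * h \<omega>) \<partial>M)"
      by (simp add: mult_ac)
  qed
  hence "exp (- L * (m + s)) * (\<integral>\<omega>. exp (L * h \<omega>) \<partial>M) \<le> exp (- L * (m + s)) * exp (L * m + \<rho> / 2 * b\<^sup>2 * L\<^sup>2)"
    by (intro mult_left_mono) auto
  also have "\<dots> = exp (\<rho> / 2 * b\<^sup>2 * L\<^sup>2 - L * s)"
    by (simp add: algebra_simps flip: exp_add)
  also have "\<rho> / 2 * b\<^sup>2 * L\<^sup>2 - L * s = - s\<^sup>2 / (2 * \<rho> * b\<^sup>2)"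
    using \<rho> b by (simp add: L_def field_simps power2_eq_square)
  finally show ?thesis
    using prob_ge_le_exp_mult_expectation[OF h_meas L, of "m + s"]
    by (simp add: m_def algebra_simps)
qed

lemma mLSI_expectation_exp_le:
  assumes M: "prob_space M" and D: "difference_operator M A \<Gamma>" and mLSI: "mLSI M A \<Gamma> \<rho>"
    and h: "h \<in> A" and k: "k \<in> borel_measurable M" "bounded (k ` space M)"
    and le: "\<And>\<omega>. \<omega> \<in> space M \<Longrightarrow> \<Gamma> h \<omega> \<le> k \<omega>" and L: "0 < L"
  shows "(\<integral>\<omega>. exp (L * h \<omega>) \<partial>M)
    \<le> exp (L * (\<integral>\<omega>. h \<omega> \<partial>M)) * (\<integral>\<omega>. exp (\<rho> * L\<^sup>2 * (k \<omega>)\<^sup>2) \<partial>M)"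
proof -
  interpret prob_space M by (rule M)
  have h_meas: "h \<in> borel_measurable M" "bounded (h ` space M)"
    using D h by (auto simp: difference_operator_def)
  define X where "X \<omega> = \<rho> * L\<^sup>2 * (k \<omega>)\<^sup>2" for \<omega>
  have X: "X \<in> borel_measurable M" "bounded (X ` space M)"
    unfolding X_def using k by (auto intro!: bounded_image_continuous[of "\<lambda>x. \<rho> * L\<^sup>2 * x\<^sup>2"] continuous_intros)
  define \<beta> where "\<beta> = ln (\<integral>\<omega>. exp (X \<omega>) \<partial>M)"
  \<comment> \<open>The Herbst constant \<open>\<beta> / L\<^sup>2\<close> depends on the endpoint
    \<open>L\<close> but not on \<open>l\<close>, and contributes exactly \<open>\<beta>\<close> at
    \<open>l = L\<close>.\<close>
  have "(\<integral>\<omega>. exp (L * h \<omega>) \<partial>M) \<le> exp (L * (\<integral>\<omega>. h \<omega> \<partial>M) + \<beta> / L\<^sup>2 * L\<^sup>2)"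
  proof (rule Herbst[OF h_meas L])
    fix l assume l: "0 < l" "l \<le> L"
    define s where "s = (l / L)\<^sup>2"
    have s: "0 \<le> s" "s \<le> 1"
      using l L by (auto simp: s_def power_le_one)
    have sX: "s * X \<omega> = \<rho> * l\<^sup>2 * (k \<omega>)\<^sup>2" for \<omega>
      using L by (simp add: s_def X_def power_divide)
    have sX_meas: "(\<lambda>\<omega>. s * X \<omega>) \<in> borel_measurable M" "bounded ((\<lambda>\<omega>. s * X \<omega>) ` space M)"
      using X by (auto intro!: bounded_image_continuous[of "\<lambda>x. s * x"] continuous_intros)
    have lh_meas: "(\<lambda>\<omega>. l * h \<omega>) \<in> borel_measurable M" "bounded ((\<lambda>\<omega>. l * h \<omega>) ` space M)"
      using h_meas by (auto intro!: bounded_image_continuous[of "\<lambda>x. l * x"] continuous_intros)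
    let ?E = "Ent M (\<lambda>\<omega>. exp (l * h \<omega>))" and ?u = "\<integral>\<omega>. exp (l * h \<omega>) \<partial>M"
    have "?E \<le> \<rho> / 2 * l\<^sup>2 * (\<integral>\<omega>. (k \<omega>)\<^sup>2 * exp (l * h \<omega>) \<partial>M)"
      using l by (intro mLSI_imp_Ent_exp_le[OF M D mLSI h k] le) auto
    also have "\<dots> = (\<integral>\<omega>. s * X \<omega> * exp (l * h \<omega>) \<partial>M) / 2"
      by (simp add: sX mult.assoc)
    finally have "2 * ?E \<le> (\<integral>\<omega>. s * X \<omega> * exp (l * h \<omega>) \<partial>M)"
      by simp
    \<comment> \<open>Taking \<open>\<rho>\<close> rather than \<open>\<rho> / 2\<close> in
      \<open>X\<close> doubles the entropy on the left, so that the single copy produced by duality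
      can be absorbed.\<close>
    also have "\<dots> \<le> ?E + ?u * ln (\<integral>\<omega>. exp (s * X \<omega>) \<partial>M)"
      by (rule expectation_mult_exp_le_Ent[OF lh_meas sX_meas])
    finally have "?E \<le> ?u * ln (\<integral>\<omega>. exp (s * X \<omega>) \<partial>M)"
      by simp
    also have "\<dots> \<le> ?u * (s * \<beta>)"
      unfolding \<beta>_def using ln_expectation_exp_scale_le[OF X s] by (intro mult_left_mono integral_nonneg) auto
    finally show "?E \<le> \<beta> / L\<^sup>2 * l\<^sup>2 * ?u"
      by (simp add: s_def power_divide mult_ac)
  qed
  also have "\<dots> = exp (L * (\<integral>\<omega>. h \<omega> \<partial>M)) * exp \<beta>"
    using L by (simp add: exp_add)
  also have "exp \<beta> = (\<integral>\<omega>. exp (X \<omega>) \<partial>M)"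
    unfolding \<beta>_def using expectation_exp_pos[OF X, of 1] by simp
  finally show ?thesis by (simp add: X_def)
qed

section \<open>The two-level rate and the choice of the Chernoff parameter\<close>

lemma two_level_rate_0: "two_level_rate m b 0 = 0"
  by (simp add: two_level_rate_def zero_ereal_def[symmetric] min_def)

text \<open>For \<open>m = 0\<close> the first quotient is infinite, so the minimum is the linear
  term.\<close>

lemma two_level_rate_pos:
  assumes "0 < b" and "0 < t"
  shows "two_level_rate m b t = (if m = 0 then t / b else min (t\<^sup>2 / m\<^sup>2) (t / b))"
  using assms by (auto simp: two_level_rate_def min_def zero_ereal_def[symmetric] divide_ereal_def divide_inverse)

text \<open>The exponent is minimised at \<open>t / (4 * \<rho> * m\<^sup>2)\<close>, with value
  \<open>- t\<^sup>2 / (8 * \<rho> * m\<^sup>2)\<close>. If the cap is reached first, the quadratic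
  term is at most half of \<open>L * t\<close>, leaving
  \<open>- t / (8 * \<rho> * b)\<close>.\<close>

lemma two_level_rate_Chernoff:
  assumes "0 < \<rho>" and "0 < b" and "0 < t"
  obtains L where "0 < L" and "L \<le> 1 / (4 * \<rho> * b)"
    and "2 * \<rho> * L\<^sup>2 * m\<^sup>2 - L * t \<le> - (1 / (8 * \<rho>)) * two_level_rate m b t"
\<comment> \<open>The case \<open>m = 0\<close> is listed separately because real division by zero
  would make the second disjunct false, although the minimiser is then infinite.\<close>
proof (cases "m = 0 \<or> 1 / (4 * \<rho> * b) \<le> t / (4 * \<rho> * m\<^sup>2)")
  case True
  define L where "L = 1 / (4 * \<rho> * b)"
  have L: "0 < L" using assms by (simp add: L_def)
  have "4 * \<rho> * L * m\<^sup>2 \<le> t"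
    using True assms by (cases "m = 0") (auto simp: L_def field_simps)
  hence "L * (4 * \<rho> * L * m\<^sup>2) \<le> L * t"
    using L by (intro mult_left_mono) auto
  hence "2 * \<rho> * L\<^sup>2 * m\<^sup>2 - L * t \<le> - (1 / 2) * (L * t)"
    by (simp add: power2_eq_square mult_ac)
  also have "\<dots> = - (1 / (8 * \<rho>)) * (t / b)"
    by (simp add: L_def)
  also have "\<dots> \<le> - (1 / (8 * \<rho>)) * two_level_rate m b t"
    using assms by (intro mult_left_mono_neg) (auto simp: two_level_rate_pos)
  finally show ?thesis using L that[of L] by (simp add: L_def)
next
  case False
  define L where "L = t / (4 * \<rho> * m\<^sup>2)"
  have L: "0 < L" using assms False by (simp add: L_def)
  have "2 * \<rho> * L\<^sup>2 * m\<^sup>2 - L * t = - (1 / (8 * \<rho>)) * (t\<^sup>2 / m\<^sup>2)"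
    using assms False by (simp add: L_def field_simps power2_eq_square)
  also have "\<dots> \<le> - (1 / (8 * \<rho>)) * two_level_rate m b t"
    using assms False by (intro mult_left_mono_neg) (auto simp: two_level_rate_pos)
  finally show ?thesis using L that[of L] False by (simp add: L_def)
qed

section \<open>The two-level tail bounds\<close>

lemma two_level_upper_tail:
  assumes M: "prob_space M" and D: "difference_operator M A \<Gamma>" and mLSI: "mLSI M A \<Gamma> \<rho>"
    and f: "f \<in> A" and g: "g \<in> A" and fg: "\<And>\<omega>. \<omega> \<in> space M \<Longrightarrow> \<Gamma> f \<omega> \<le> g \<omega>"
    and b: "0 < b" and gb: "\<And>\<omega>. \<omega> \<in> space M \<Longrightarrow> \<Gamma> g \<omega> \<le> b" and t: "0 \<le> t"
  shows "measure M {\<omega> \<in> space M. f \<omega> - (\<integral>x. f x \<partial>M) \<ge> t}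
    \<le> 4 / 3 * exp (- (1 / (8 * \<rho>)) * two_level_rate (\<integral>x. g x \<partial>M) b t)"
proof (cases "t = 0")
  case True
  interpret prob_space M by (rule M)
  show ?thesis
    \<comment> \<open>At \<open>t = 0\<close> the bound is \<open>4 / 3\<close>, which exceeds any
      probability.\<close>
    unfolding True by (rule order_trans[OF prob_le_1]) (simp add: two_level_rate_0)
next
  case False
  hence t: "0 < t" using t by simp
  interpret prob_space M by (rule M)
  have \<rho>: "0 < \<rho>" using mLSI by (simp add: mLSI_def)
  have f_meas: "f \<in> borel_measurable M" "bounded (f ` space M)"
    and g_meas: "g \<in> borel_measurable M" "bounded (g ` space M)"
    and f_nonneg: "\<And>\<omega>. \<omega> \<in> space M \<Longrightarrow> 0 \<le> \<Gamma> f \<omega>"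
    using D f g by (auto simp: difference_operator_def)
  have g_nonneg: "0 \<le> g \<omega>" if "\<omega> \<in> space M" for \<omega>
    using f_nonneg[OF that] fg[OF that] by simp
  define m where "m = (\<integral>x. g x \<partial>M)"
  obtain L where L: "0 < L" "L \<le> 1 / (4 * \<rho> * b)"
    and rate: "2 * \<rho> * L\<^sup>2 * m\<^sup>2 - L * t \<le> - (1 / (8 * \<rho>)) * two_level_rate m b t"
    using two_level_rate_Chernoff[OF \<rho> b t] .
  \<comment> \<open>Chosen so that \<open>exp (- 4 * c * s\<^sup>2)\<close> is the Gaussian tail
    bound for \<open>g - m\<close>. The cap on \<open>L\<close> is precisely what gives
    \<open>2 * \<rho> * L\<^sup>2 \<le> c\<close>.\<close>
  define c where "c = 1 / (8 * \<rho> * b\<^sup>2)"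
  have c: "0 < c" using \<rho> b by (simp add: c_def)
  have "L\<^sup>2 \<le> (1 / (4 * \<rho> * b))\<^sup>2"
    using L by (intro power_mono) auto
  hence "2 * \<rho> * L\<^sup>2 \<le> 2 * \<rho> * (1 / (4 * \<rho> * b))\<^sup>2"
    using \<rho> by (intro mult_left_mono) auto
  also have "\<dots> = c" using \<rho> b by (simp add: c_def power2_eq_square)
  finally have Lc: "2 * \<rho> * L\<^sup>2 \<le> c" .
  have gm: "(\<lambda>\<omega>. g \<omega> - m) \<in> borel_measurable M" "bounded ((\<lambda>\<omega>. g \<omega> - m) ` space M)"
    using g_meas bounded_translation_minus[of "g ` space M" m] by (auto simp: image_image)
  have gauss: "(\<integral>\<omega>. exp (c * (max 0 (g \<omega> - m))\<^sup>2) \<partial>M) \<le> 4 / 3"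
  proof (rule expectation_exp_square_le[OF gm c])
    fix s :: real assume s: "0 < s"
    show "prob {\<omega> \<in> space M. s \<le> g \<omega> - m} \<le> exp (- 4 * c * s\<^sup>2)"
      using mLSI_Lipschitz_tail[OF M D mLSI g b gb s] by (simp add: m_def c_def mult.assoc)
  qed
  have pw: "\<rho> * L\<^sup>2 * (g \<omega>)\<^sup>2 \<le> 2 * \<rho> * L\<^sup>2 * m\<^sup>2 + c * (max 0 (g \<omega> - m))\<^sup>2"
    if w: "\<omega> \<in> space M" for \<omega>
  proof -
    define d where "d = max 0 (g \<omega> - m)"
    \<comment> \<open>Squaring \<open>g \<omega> \<le> m + d\<close> is legitimate because
      \<open>g \<ge> \<Gamma> f \<ge> 0\<close>; hence only the upper deviation of \<open>g\<close>
      enters.\<close>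
    have "(g \<omega>)\<^sup>2 \<le> (m + d)\<^sup>2"
      using g_nonneg[OF w] by (intro power_mono) (auto simp: d_def)
    also have "\<dots> \<le> 2 * m\<^sup>2 + 2 * d\<^sup>2"
      using sum_squares_ge_zero[of "m - d" 0] by (simp add: power2_eq_square algebra_simps)
    finally have "\<rho> * L\<^sup>2 * (g \<omega>)\<^sup>2 \<le> \<rho> * L\<^sup>2 * (2 * m\<^sup>2 + 2 * d\<^sup>2)"
      using \<rho> by (intro mult_left_mono) auto
    also have "\<dots> = 2 * \<rho> * L\<^sup>2 * m\<^sup>2 + 2 * \<rho> * L\<^sup>2 * d\<^sup>2"
      by (simp add: algebra_simps)
    also have "\<dots> \<le> 2 * \<rho> * L\<^sup>2 * m\<^sup>2 + c * d\<^sup>2"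
      using Lc by (intro add_left_mono mult_right_mono) auto
    finally show ?thesis by (simp add: d_def)
  qed
  have "(\<integral>\<omega>. exp (\<rho> * L\<^sup>2 * (g \<omega>)\<^sup>2) \<partial>M)
      \<le> (\<integral>\<omega>. exp (2 * \<rho> * L\<^sup>2 * m\<^sup>2) * exp (c * (max 0 (g \<omega> - m))\<^sup>2) \<partial>M)"
    using pw
    by (intro integral_mono
        integrable_continuous_bounded[OF _ g_meas, of "\<lambda>x. exp (\<rho> * L\<^sup>2 * x\<^sup>2)"]
        integrable_continuous_bounded[OF _ g_meas, of "\<lambda>x. exp (2 * \<rho> * L\<^sup>2 * m\<^sup>2) * exp (c * (max 0 (x - m))\<^sup>2)"])
       (auto intro!: continuous_intros simp flip: exp_add)
  also have "\<dots> \<le> exp (2 * \<rho> * L\<^sup>2 * m\<^sup>2) * (4 / 3)"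
    using gauss by simp
  finally have mgf: "(\<integral>\<omega>. exp (\<rho> * L\<^sup>2 * (g \<omega>)\<^sup>2) \<partial>M) \<le> exp (2 * \<rho> * L\<^sup>2 * m\<^sup>2) * (4 / 3)" .
  define \<mu> where "\<mu> = (\<integral>x. f x \<partial>M)"
  have "prob {\<omega> \<in> space M. \<mu> + t \<le> f \<omega>} \<le> exp (- L * (\<mu> + t)) * (\<integral>\<omega>. exp (L * f \<omega>) \<partial>M)"
    by (rule prob_ge_le_exp_mult_expectation[OF f_meas L(1)])
  also have "\<dots> \<le> exp (- L * (\<mu> + t)) * (exp (L * \<mu>) * (exp (2 * \<rho> * L\<^sup>2 * m\<^sup>2) * (4 / 3)))"
    using order_trans[OF mLSI_expectation_exp_le[OF M D mLSI f g_meas fg L(1)] mult_left_mono[OF mgf]]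
    by (intro mult_left_mono) (auto simp: \<mu>_def)
  also have "\<dots> = 4 / 3 * exp (2 * \<rho> * L\<^sup>2 * m\<^sup>2 - L * t)"
    by (simp add: algebra_simps flip: exp_add)
  also have "\<dots> \<le> 4 / 3 * exp (- (1 / (8 * \<rho>)) * two_level_rate m b t)"
    using rate by (intro mult_left_mono) auto
  finally show ?thesis by (simp add: \<mu>_def m_def algebra_simps)
qed

theorem corollary1p2:
  fixes M :: "'a measure"
    and A :: "('a \<Rightarrow> real) set"
    and \<Gamma> :: "('a \<Rightarrow> real) \<Rightarrow> 'a \<Rightarrow> real"
    and f g :: "'a \<Rightarrow> real"
    and \<rho> b :: real
  assumes "prob_space M"
    and "difference_operator M A \<Gamma>"
    and "\<rho> > 0"
    and "mLSI M A \<Gamma> \<rho>"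
    and "f \<in> A" and "g \<in> A"
    and "\<forall>\<omega>\<in>space M. \<Gamma> f \<omega> \<le> g \<omega>"
    and "b > 0"
    and "\<forall>\<omega>\<in>space M. \<Gamma> g \<omega> \<le> b"
  shows "(\<forall>t\<ge>0. measure M {\<omega> \<in> space M. f \<omega> - (\<integral>x. f x \<partial>M) \<ge> t}
            \<le> 4 / 3 * exp (- (1 / (8 * \<rho>)) * two_level_rate (\<integral>x. g x \<partial>M) b t))
       \<and> ((\<forall>h\<in>A. \<forall>a::real. (\<lambda>\<omega>. a * h \<omega>) \<in> A \<and>
              (\<forall>\<omega>\<in>space M. \<Gamma> (\<lambda>\<omega>'. a * h \<omega>') \<omega> = \<bar>a\<bar> * \<Gamma> h \<omega>))
          \<longrightarrow> (\<forall>t\<ge>0. measure M {\<omega> \<in> space M. (\<integral>x. f x \<partial>M) - f \<omega> \<ge> t}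
            \<le> 4 / 3 * exp (- (1 / (8 * \<rho>)) * two_level_rate (\<integral>x. g x \<partial>M) b t)))"
proof (intro conjI impI allI)
  show "measure M {\<omega> \<in> space M. f \<omega> - (\<integral>x. f x \<partial>M) \<ge> t}
      \<le> 4 / 3 * exp (- (1 / (8 * \<rho>)) * two_level_rate (\<integral>x. g x \<partial>M) b t)" if "0 \<le> t" for t
    using assms that by (intro two_level_upper_tail) auto
  fix t :: real
  assume hom: "\<forall>h\<in>A. \<forall>a::real. (\<lambda>\<omega>. a * h \<omega>) \<in> A \<and>
    (\<forall>\<omega>\<in>space M. \<Gamma> (\<lambda>\<omega>'. a * h \<omega>') \<omega> = \<bar>a\<bar> * \<Gamma> h \<omega>)" and t: "0 \<le> t"
  \<comment> \<open>The upper tail of \<open>-f\<close> is the lower tail of \<open>f\<close>, and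
    \<open>\<bar>-1\<bar> = 1\<close> gives \<open>\<Gamma> (-f) = \<Gamma> f \<le> g\<close> on the
    space, so the same \<open>g\<close> serves.\<close>
  have "measure M {\<omega> \<in> space M. -1 * f \<omega> - (\<integral>x. -1 * f x \<partial>M) \<ge> t}
      \<le> 4 / 3 * exp (- (1 / (8 * \<rho>)) * two_level_rate (\<integral>x. g x \<partial>M) b t)"
  proof (rule two_level_upper_tail[OF assms(1,2,4) _ assms(6) _ assms(8) _ t])
    show "(\<lambda>\<omega>. -1 * f \<omega>) \<in> A"
      using hom assms(5) by blast
    show "\<Gamma> (\<lambda>\<omega>. -1 * f \<omega>) \<omega> \<le> g \<omega>" if "\<omega> \<in> space M" for \<omega>
      using hom[rule_format, OF assms(5), of "-1"] assms(7) that by simp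
  qed (use assms(9) in blast)
  thus "measure M {\<omega> \<in> space M. (\<integral>x. f x \<partial>M) - f \<omega> \<ge> t}
      \<le> 4 / 3 * exp (- (1 / (8 * \<rho>)) * two_level_rate (\<integral>x. g x \<partial>M) b t)"
    by simp
qed

end
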